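(* Let $\mu$ be a box-like self-affine measure of separated type and let $q\geq0$. If $\max\{\gamma_A(q),\gamma_B(q)\}\leq\tau_1(q)+\tau_2(q)$, then \[ \gamma(q)=\max\{\gamma_A(q),\gamma_B(q)\}. \] If $\min\{\gamma_A(q),\gamma_B(q)\}\geq\tau_1(q)+\tau_2(q)$, then \[ \gamma(q)\leq\min\{\gamma_A(q),\gamma_B(q)\}, \] with equality occurring if either of the following is satisfied: (1) $\sum_{i\in\mathcal I}p_i^q\,c_i^{\tau_1(q)}\,d_i^{\gamma_A(q)-\tau_1(q)}\log(c_i/d_i)\geq0$; (2) $\sum_{i\in\mathcal I}p_i^q\,d_i^{\tau_2(q)}\,c_i^{\gamma_B(q)-\tau_2(q)}\log(d_i/c_i)\geq0$. Moreover, if $c_i\geq d_i$ for all $i\in\mathcal I$, then $\gamma(q)=\gamma_A(q)$ for all $q\geq0$, and if $d_i\geq c_i$ for all $i\in\mathcal I$, then $\gamma(q)=\gamma_B(q)$ for all $q\geq0$, without any additional assumptions.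
   Context: Box-like self-affine measure of separated type: $\mathcal I$ is a finite index set with $|\mathcal I|\ge2$; for each $i\in\mathcal I$, $S_i:\mathbb{R}^2\to\mathbb{R}^2$ is an affine map with linear part $\begin{pmatrix}\pm c_i&0\\0&\pm d_i\end{pmatrix}$, $c_i,d_i\in(0,1)$ (signs depending on $i$), and $S_i([0,1]^2)\subseteq[0,1]^2$; $(p_i)_{i\in\mathcal I}$ is a probability vector with all $p_i\in(0,1)$; $\mu$ is the unique Borel probability measure with $\mu=\sum_{i\in\mathcal I}p_i\,\mu\circ S_i^{-1}$. For a compactly supported Borel probability measure $\nu$, $\tau_\nu(q)=\lim_{\delta\to0}\log\int_{\operatorname{supp}\nu}\nu(B(x,\delta))^{q-1}d\nu(x)/(-\log\delta)$ when the limit exists ($L^q$-spectrum). Let $\pi_1(x,y)=x$, $\pi_2(x,y)=y$, $\pi_j(\mu)=\mu\circ\pi_j^{-1}$, and $\tau_j(q)=\tau_{\pi_j(\mu)}(q)$, which exists for all $q\ge0$. For $\mathbf i=(i_1,\dots,i_k)\in\mathcal I^k$ put $p(\mathbf i)=p_{i_1}\cdots p_{i_k}$, $c_{\mathbf i}=c_{i_1}\cdots c_{i_k}$, $d_{\mathbf i}=d_{i_1}\cdots d_{i_k}$, $\alpha_1(\mathbf i)=\max\{c_{\mathbf i},d_{\mathbf i}\}$, $\alpha_2(\mathbf i)=\min\{c_{\mathbf i},d_{\mathbf i}\}$, and $\tau_{\mathbf i}=\tau_1$ if $c_{\mathbf i}\ge d_{\mathbf i}$, $\tau_{\mathbf i}=\tau_2$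 otherwise. For $s\in\mathbb{R}$, $q\ge0$ let $\psi^{s,q}(\mathbf i)=p(\mathbf i)^q\alpha_1(\mathbf i)^{\tau_{\mathbf i}(q)}\alpha_2(\mathbf i)^{s-\tau_{\mathbf i}(q)}$, $\Psi_k^{s,q}=\sum_{\mathbf i\in\mathcal I^k}\psi^{s,q}(\mathbf i)$, $P(s,q)=\lim_{k\to\infty}(\Psi_k^{s,q})^{1/k}$ (the limit exists), and let $\gamma(q)$ be the unique real number with $P(\gamma(q),q)=1$. The functions $\gamma_A,\gamma_B:[0,\infty)\to\mathbb{R}$ are defined by $\sum_{i\in\mathcal I}p_i^q\,c_i^{\tau_1(q)}d_i^{\gamma_A(q)-\tau_1(q)}=1$ and $\sum_{i\in\mathcal I}p_i^q\,d_i^{\tau_2(q)}c_i^{\gamma_B(q)-\tau_2(q)}=1$. *)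

theory Defs
  imports "HOL-Probability.Probability"
begin

locale box_like_self_affine_measure = prob_space \<mu>
  for \<mu> :: "(real \<times> real) measure" +
  fixes I :: "'i set"
    and S :: "'i \<Rightarrow> real \<times> real \<Rightarrow> real \<times> real"
    and c d p :: "'i \<Rightarrow> real"
  assumes finite_I: "finite I"
    and card_I: "card I \<ge> 2"
    and c_range: "\<And>i. i \<in> I \<Longrightarrow> 0 < c i \<and> c i < 1"
    and d_range: "\<And>i. i \<in> I \<Longrightarrow> 0 < d i \<and> d i < 1"
    and S_affine: "\<And>i. i \<in> I \<Longrightarrow>
      \<exists>\<epsilon>\<in>{-1, 1}. \<exists>\<eta>\<in>{-1, 1}. \<exists>a b. \<forall>x y. S i (x, y) = (\<epsilon> * c i * x + a, \<eta> * d i * y + b)"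
    and S_unit_square: "\<And>i. i \<in> I \<Longrightarrow> S i ` ({0..1} \<times> {0..1}) \<subseteq> {0..1} \<times> {0..1}"
    and p_range: "\<And>i. i \<in> I \<Longrightarrow> 0 < p i \<and> p i < 1"
    and p_sum: "(\<Sum>i\<in>I. p i) = 1"
    and sets_\<mu>: "sets \<mu> = sets borel"
    and self_affine: "\<And>A. A \<in> sets borel \<Longrightarrow>
      measure \<mu> A = (\<Sum>i\<in>I. p i * measure \<mu> (S i -` A))"

definition measure_support :: "'a::topological_space measure \<Rightarrow> 'a set" where
  "measure_support \<nu> = {x. \<forall>U. open U \<and> x \<in> U \<longrightarrow> emeasure \<nu> U > 0}"

(* Lim is unspecified where the limit does not exist.  The balls are taken closed. *)
definition Lq_spectrum :: "'a::metric_space measure \<Rightarrow> real \<Rightarrow> real" where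
  "Lq_spectrum \<nu> q = Lim (at_right 0)
     (\<lambda>\<delta>. ln (LINT x:measure_support \<nu>|\<nu>. measure \<nu> (cball x \<delta>) powr (q - 1)) / (- ln \<delta>))"

definition tau1 :: "(real \<times> real) measure \<Rightarrow> real \<Rightarrow> real" where
  "tau1 \<mu> q = Lq_spectrum (distr \<mu> borel fst) q"

definition tau2 :: "(real \<times> real) measure \<Rightarrow> real \<Rightarrow> real" where
  "tau2 \<mu> q = Lq_spectrum (distr \<mu> borel snd) q"

definition words :: "'i set \<Rightarrow> nat \<Rightarrow> 'i list set" where
  "words I k = {w. set w \<subseteq> I \<and> length w = k}"

definition word_prod :: "('i \<Rightarrow> real) \<Rightarrow> 'i list \<Rightarrow> real" where
  "word_prod f w = prod_list (map f w)"

definition alpha1 :: "('i \<Rightarrow> real) \<Rightarrow> ('i \<Rightarrow> real) \<Rightarrow> 'i list \<Rightarrow> real" where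
  "alpha1 c d w = max (word_prod c w) (word_prod d w)"

definition alpha2 :: "('i \<Rightarrow> real) \<Rightarrow> ('i \<Rightarrow> real) \<Rightarrow> 'i list \<Rightarrow> real" where
  "alpha2 c d w = min (word_prod c w) (word_prod d w)"

definition tau_word ::
  "(real \<times> real) measure \<Rightarrow> ('i \<Rightarrow> real) \<Rightarrow> ('i \<Rightarrow> real) \<Rightarrow> 'i list \<Rightarrow> real \<Rightarrow> real" where
  "tau_word \<mu> c d w q = (if word_prod c w \<ge> word_prod d w then tau1 \<mu> q else tau2 \<mu> q)"

definition psi ::
  "(real \<times> real) measure \<Rightarrow> ('i \<Rightarrow> real) \<Rightarrow> ('i \<Rightarrow> real) \<Rightarrow> ('i \<Rightarrow> real) \<Rightarrow> real \<Rightarrow> real \<Rightarrow> 'i list \<Rightarrow> real"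
  where
  "psi \<mu> c d p s q w = word_prod p w powr q
     * alpha1 c d w powr tau_word \<mu> c d w q
     * alpha2 c d w powr (s - tau_word \<mu> c d w q)"

definition Psi ::
  "(real \<times> real) measure \<Rightarrow> 'i set \<Rightarrow> ('i \<Rightarrow> real) \<Rightarrow> ('i \<Rightarrow> real) \<Rightarrow> ('i \<Rightarrow> real) \<Rightarrow> real \<Rightarrow> real \<Rightarrow> nat \<Rightarrow> real"
  where
  "Psi \<mu> I c d p s q k = (\<Sum>w\<in>words I k. psi \<mu> c d p s q w)"

definition pressure ::
  "(real \<times> real) measure \<Rightarrow> 'i set \<Rightarrow> ('i \<Rightarrow> real) \<Rightarrow> ('i \<Rightarrow> real) \<Rightarrow> ('i \<Rightarrow> real) \<Rightarrow> real \<Rightarrow> real \<Rightarrow> real"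
  where
  "pressure \<mu> I c d p s q = lim (\<lambda>k. root k (Psi \<mu> I c d p s q k))"

definition gamma ::
  "(real \<times> real) measure \<Rightarrow> 'i set \<Rightarrow> ('i \<Rightarrow> real) \<Rightarrow> ('i \<Rightarrow> real) \<Rightarrow> ('i \<Rightarrow> real) \<Rightarrow> real \<Rightarrow> real"
  where
  "gamma \<mu> I c d p q = (THE s. pressure \<mu> I c d p s q = 1)"

definition gammaA ::
  "(real \<times> real) measure \<Rightarrow> 'i set \<Rightarrow> ('i \<Rightarrow> real) \<Rightarrow> ('i \<Rightarrow> real) \<Rightarrow> ('i \<Rightarrow> real) \<Rightarrow> real \<Rightarrow> real"
  where
  "gammaA \<mu> I c d p q =
     (THE s. (\<Sum>i\<in>I. p i powr q * c i powr tau1 \<mu> q * d i powr (s - tau1 \<mu> q)) = 1)"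

definition gammaB ::
  "(real \<times> real) measure \<Rightarrow> 'i set \<Rightarrow> ('i \<Rightarrow> real) \<Rightarrow> ('i \<Rightarrow> real) \<Rightarrow> ('i \<Rightarrow> real) \<Rightarrow> real \<Rightarrow> real"
  where
  "gammaB \<mu> I c d p q =
     (THE s. (\<Sum>i\<in>I. p i powr q * d i powr tau2 \<mu> q * c i powr (s - tau2 \<mu> q)) = 1)"

end

theory Submission
  imports Defs
begin

text \<open>
  Write \<open>A\<close> and \<open>B\<close> for the multiplicative weights on words whose sums over letters define
  \<open>\<gamma>\<^sub>A\<close> and \<open>\<gamma>\<^sub>B\<close>. Since \<open>B / A = (c / d) powr (s - (\<tau>\<^sub>1 + \<tau>\<^sub>2))\<close>, the singular value
  function \<open>\<psi>\<close> is \<open>max A B\<close> for \<open>s \<le> \<tau>\<^sub>1 + \<tau>\<^sub>2\<close> and \<open>min A B\<close> for \<open>s \<ge> \<tau>\<^sub>1 + \<tau>\<^sub>2\<close>. In the first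
  case the pressure is the larger of the two letter sums; in the second it exists by
  supermultiplicativity and is at most the smaller one. Shifting \<open>s\<close> scales \<open>\<psi>\<close> by a power of
  \<open>\<alpha>\<^sub>2\<close>, so the pressure decreases geometrically and takes the value 1 exactly once.
  If \<open>s = \<gamma>\<^sub>A\<close>, the weights \<open>A\<close> form a Bernoulli measure under which \<open>ln (B / A)\<close> is a random walk
  with nonnegative drift; by Jensen's inequality the sum of \<open>A * min 1 (B / A)\<close> over words of
  length \<open>k\<close> is at least \<open>exp (- O(sqrt k))\<close>, so the pressure is at least 1.
\<close>

section \<open>Words\<close>

lemma finite_words: "finite I \<Longrightarrow> finite (words I k)"
  unfolding words_def by (rule finite_lists_length_eq)

lemma words_0 [simp]: "words I 0 = {[]}"
  by (auto simp: words_def)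

lemma words_Suc: "words I (Suc k) = (\<lambda>(i, w). i # w) ` (I \<times> words I k)"
  by (auto simp: words_def image_iff length_Suc_conv)

lemma word_prod_simps [simp]:
  "word_prod f [] = 1"
  "word_prod f (i # w) = f i * word_prod f w"
  "word_prod f (v @ w) = word_prod f v * word_prod f w"
  by (simp_all add: word_prod_def)

lemma sum_words_Suc:
  "(\<Sum>w\<in>words I (Suc k). F w) = (\<Sum>i\<in>I. \<Sum>w\<in>words I k. F (i # w))"
  by (simp add: words_Suc sum.reindex inj_on_def sum.cartesian_product split_def)

lemma sum_words_add:
  "(\<Sum>w\<in>words I (m + n). F w) = (\<Sum>v\<in>words I m. \<Sum>w\<in>words I n. F (v @ w))"
  by (induction m arbitrary: F) (simp_all add: sum_words_Suc)

lemma sum_word_prod: "(\<Sum>w\<in>words I k. word_prod f w) = (\<Sum>i\<in>I. f i) ^ k"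
  for f :: "'i \<Rightarrow> real"
  by (induction k)
     (simp_all add: sum_words_Suc sum_distrib_left[symmetric] sum_distrib_right[symmetric])

lemma word_prod_pos:
  assumes "\<And>i. i \<in> I \<Longrightarrow> 0 < f i" "w \<in> words I k"
  shows "0 < word_prod f w"
proof -
  have "set w \<subseteq> I" using assms(2) by (simp add: words_def)
  then show ?thesis by (induction w) (auto simp: assms(1))
qed

lemma word_prod_mono:
  assumes "\<And>i. i \<in> I \<Longrightarrow> 0 < f i \<and> f i \<le> f' i" "w \<in> words I k"
  shows "word_prod f w \<le> word_prod f' w"
proof -
  have *: "set w \<subseteq> I" using assms(2) by (simp add: words_def)
  then have "0 \<le> word_prod f w \<and> word_prod f w \<le> word_prod f' w"
  proof (induction w)
    case (Cons i w)
    then have "0 < f i" "f i \<le> f' i" "0 \<le> word_prod f w" "word_prod f w \<le> word_prod f' w"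
      using assms(1) by auto
    then show ?case by (simp add: mult_mono)
  qed simp
  then show ?thesis by simp
qed

lemma word_prod_const: "w \<in> words I k \<Longrightarrow> word_prod (\<lambda>_. a) w = a ^ k"
proof -
  have "word_prod (\<lambda>_. a) w = a ^ length w" by (induction w) simp_all
  then show "w \<in> words I k \<Longrightarrow> ?thesis" by (simp add: words_def)
qed

lemma word_prod_powr:
  assumes "\<And>i. i \<in> I \<Longrightarrow> 0 < f i" "w \<in> words I k"
  shows "word_prod (\<lambda>i. f i powr t) w = word_prod f w powr t"
proof -
  have "set w \<subseteq> I" using assms(2) by (simp add: words_def)
  then have "0 < word_prod f w \<and> word_prod (\<lambda>i. f i powr t) w = word_prod f w powr t"
    by (induction w) (auto simp: assms(1) powr_mult)
  then show ?thesis by simp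
qed

lemma word_prod_mult: "word_prod (\<lambda>i. f i * f' i) w = word_prod f w * word_prod f' w"
  by (induction w) simp_all

lemma ln_word_prod:
  assumes "\<And>i. i \<in> I \<Longrightarrow> 0 < f i" "w \<in> words I k"
  shows "ln (word_prod f w) = sum_list (map (\<lambda>i. ln (f i)) w)"
proof -
  have "set w \<subseteq> I" using assms(2) by (simp add: words_def)
  then have "0 < word_prod f w \<and> ln (word_prod f w) = sum_list (map (\<lambda>i. ln (f i)) w)"
    by (induction w) (auto simp: assms(1) ln_mult_pos)
  then show ?thesis by simp
qed

section \<open>Moments of sums over random words\<close>

lemma sum_words_first_moment:
  fixes a Y :: "'i \<Rightarrow> real"
  assumes "(\<Sum>i\<in>I. a i) = 1" "(\<Sum>i\<in>I. a i * Y i) = 0"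
  shows "(\<Sum>w\<in>words I k. word_prod a w * sum_list (map Y w)) = 0"
proof (induction k)
  case (Suc k)
  have "(\<Sum>w\<in>words I (Suc k). word_prod a w * sum_list (map Y w))
      = (\<Sum>i\<in>I. (a i * Y i) * (\<Sum>w\<in>words I k. word_prod a w)
          + a i * (\<Sum>w\<in>words I k. word_prod a w * sum_list (map Y w)))"
    by (simp add: sum_words_Suc sum_distrib_left sum.distrib[symmetric] algebra_simps)
  then show ?case
    by (simp add: Suc sum_word_prod assms)
qed simp

text \<open>The cross terms carry the first moment and vanish, so the variance of the walk with
  centred steps \<open>Y\<close> grows only linearly in \<open>k\<close>. This is the source of the
  \<open>sqrt k\<close> in the bound on the pressure.\<close>

lemma sum_words_second_moment:
  fixes a Y :: "'i \<Rightarrow> real"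
  assumes "(\<Sum>i\<in>I. a i) = 1" "(\<Sum>i\<in>I. a i * Y i) = 0"
  shows "(\<Sum>w\<in>words I k. word_prod a w * (sum_list (map Y w))\<^sup>2)
      = real k * (\<Sum>i\<in>I. a i * (Y i)\<^sup>2)"
proof (induction k)
  case (Suc k)
  have "(\<Sum>w\<in>words I (Suc k). word_prod a w * (sum_list (map Y w))\<^sup>2)
      = (\<Sum>i\<in>I. (a i * (Y i)\<^sup>2) * (\<Sum>w\<in>words I k. word_prod a w)
          + 2 * a i * Y i * (\<Sum>w\<in>words I k. word_prod a w * sum_list (map Y w))
          + a i * (\<Sum>w\<in>words I k. word_prod a w * (sum_list (map Y w))\<^sup>2))"
    by (simp add: sum_words_Suc sum_distrib_left sum.distrib[symmetric] algebra_simps power2_eq_square)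
  then show ?case
    by (simp only: Suc sum_word_prod sum_words_first_moment[OF assms] assms sum.distrib
        sum_distrib_right[symmetric]) (simp add: algebra_simps)
qed simp

section \<open>Superadditive sequences and geometrically decreasing functions\<close>

text \<open>The limit is the supremum \<open>L\<close> of the slopes. A single \<open>m\<close> with
  slope close to \<open>L\<close> controls all large \<open>n\<close> through division with
  remainder by \<open>m\<close>.\<close>

lemma fekete:
  fixes u :: "nat \<Rightarrow> real"
  assumes super: "\<And>m n. u m + u n \<le> u (m + n)" and bound: "\<And>n. u n \<le> real n * M"
  shows "convergent (\<lambda>n. u n / real n)"
proof -
  \<comment> \<open>Index 0 is left out: \<open>u 0 / real 0\<close> is 0 by convention and could
    exceed all the other slopes.\<close>
  define L where "L = (SUP n\<in>{1..}. u n / real n)"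
  have le_M: "u n / real n \<le> M" if "n \<ge> 1" for n
    using that bound[of n] by (simp add: divide_simps mult.commute)
  have bdd: "bdd_above ((\<lambda>n. u n / real n) ` {1..})"
    using le_M by (auto intro!: bdd_aboveI[where M = M])
  have upper: "u n / real n \<le> L" if "n \<ge> 1" for n
    unfolding L_def using that bdd by (intro cSUP_upper) auto
  have lower: "\<forall>\<^sub>F n in sequentially. y < u n / real n" if "y < L" for y
  proof -
    have "{1::nat..} \<noteq> {}" by auto
    then obtain m where m: "m \<ge> 1" "y < u m / real m"
      using \<open>y < L\<close> bdd unfolding L_def by (auto simp: less_cSUP_iff)
    define l where "l = u m / real m"
    \<comment> \<open>Subtracting the linear part makes \<open>v\<close> superadditive with \<open>v m = 0\<close>, hence bounded below
      by its minimum over residues modulo \<open>m\<close>.\<close>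
    define v where "v n = u n - real n * l" for n
    have v_super: "v a + v b \<le> v (a + b)" for a b
      using super[of a b] by (simp add: v_def algebra_simps)
    have v_m: "v m = 0" using m(1) by (simp add: v_def l_def)
    have v_shift: "v r \<le> v (j * m + r)" for j r
    proof (induction j)
      case (Suc j)
      then show ?case using v_super[of m "j * m + r"] v_m by (simp add: add.assoc)
    qed simp
    define K where "K = Min (v ` {..<m})"
    have K: "K \<le> v n" for n
    proof -
      have "K \<le> v (n mod m)" unfolding K_def using m(1) by (intro Min_le) auto
      also have "\<dots> \<le> v n" using v_shift[of "n mod m" "n div m"] by simp
      finally show ?thesis .
    qed
    have "(\<lambda>n. l + K / real n) \<longlonglongrightarrow> l + 0"
      by (intro tendsto_add tendsto_const lim_const_over_n)
    then have "\<forall>\<^sub>F n in sequentially. y < l + K / real n"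
      using m(2) by (intro order_tendstoD) (auto simp: l_def)
    moreover have "l + K / real n \<le> u n / real n" if "n \<ge> 1" for n
    proof -
      have "l + K / real n = (real n * l + K) / real n" using that by (simp add: add_divide_distrib)
      also have "\<dots> \<le> u n / real n" using K[of n] by (intro divide_right_mono) (simp_all add: v_def)
      finally show ?thesis .
    qed
    ultimately show ?thesis
      by (auto elim!: eventually_elim2[OF _ eventually_ge_at_top[of 1]] intro: less_le_trans)
  qed
  have "(\<lambda>n. u n / real n) \<longlonglongrightarrow> L"
  proof (rule order_tendstoI[OF lower])
    fix y assume "L < y"
    then show "\<forall>\<^sub>F n in sequentially. u n / real n < y"
      by (intro eventually_sequentiallyI[of 1] le_less_trans[OF upper])
  qed
  then show ?thesis by (rule convergentI)
qed

lemma root_exp: "1 \<le> n \<Longrightarrow> root n (exp x) = exp (x / real n)"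
  by (simp add: root_powr_inverse powr_def)

text \<open>The common property of both letter sums and of the pressure. The upper rate forces
  strict decrease and arbitrarily large and small values; the lower rate excludes jumps.\<close>

definition geom_decreasing :: "(real \<Rightarrow> real) \<Rightarrow> bool" where
  "geom_decreasing G \<longleftrightarrow> (\<forall>s. 0 < G s) \<and> (\<exists>l r. 0 < l \<and> l < 1 \<and> 0 < r \<and> r < 1 \<and>
     (\<forall>s h. 0 \<le> h \<longrightarrow> l powr h * G s \<le> G (s + h) \<and> G (s + h) \<le> r powr h * G s))"

lemma geom_decreasing_strict:
  assumes "geom_decreasing G" "s < s'"
  shows "G s' < G s"
proof -
  obtain r where r: "0 < r" "r < 1" "\<And>s h. 0 \<le> h \<Longrightarrow> G (s + h) \<le> r powr h * G s"
    and pos: "0 < G s"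
    using assms(1) unfolding geom_decreasing_def by blast
  have "G s' \<le> r powr (s' - s) * G s" using r(3)[of "s' - s" s] assms(2) by simp
  also have "r powr (s' - s) < 1" using r assms(2) by (simp add: powr_def mult_pos_neg)
  then have "r powr (s' - s) * G s < G s" using pos by simp
  finally show ?thesis .
qed

lemma geom_decreasing_less_iff:
  "geom_decreasing G \<Longrightarrow> G s < G s' \<longleftrightarrow> s' < s"
  by (metis geom_decreasing_strict less_asym linorder_neqE_linordered_idom)

lemma geom_decreasing_le_iff:
  "geom_decreasing G \<Longrightarrow> G s \<le> G s' \<longleftrightarrow> s' \<le> s"
  by (metis geom_decreasing_less_iff not_less)

text \<open>The two rates make \<open>ln (G s)\<close> Lipschitz, hence continuous, and the upper
  one forces a sign change; strict decrease gives uniqueness.\<close>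

lemma geom_decreasing_ex1:
  assumes "geom_decreasing G"
  shows "\<exists>!s. G s = 1"
proof -
  obtain l r where lr: "0 < l" "l < 1" "0 < r" "r < 1"
    and lower: "\<And>s h. 0 \<le> h \<Longrightarrow> l powr h * G s \<le> G (s + h)"
    and upper: "\<And>s h. 0 \<le> h \<Longrightarrow> G (s + h) \<le> r powr h * G s"
    and pos: "\<And>s. 0 < G s"
    using assms unfolding geom_decreasing_def by blast
  have ln_upper: "ln (G (s + h)) \<le> h * ln r + ln (G s)" if "0 \<le> h" for s h
  proof -
    have "ln (G (s + h)) \<le> ln (r powr h * G s)" using upper[OF that, of s] pos lr by simp
    also have "\<dots> = h * ln r + ln (G s)" using pos[of s] lr by (simp add: ln_mult ln_powr)
    finally show ?thesis .
  qed
  have ln_lower: "h * ln l + ln (G s) \<le> ln (G (s + h))" if "0 \<le> h" for s h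
  proof -
    have "h * ln l + ln (G s) = ln (l powr h * G s)"
      using pos[of s] lr by (simp add: ln_mult ln_powr)
    also have "\<dots> \<le> ln (G (s + h))" using lower[OF that, of s] pos lr by simp
    finally show ?thesis .
  qed
  have neg: "ln r < 0" "ln l < 0" using lr by auto
  have one_sided: "\<bar>ln (G x) - ln (G y)\<bar> \<le> - ln l * (x - y)" if "y \<le> x" for x y
  proof -
    have "(x - y) * ln r \<le> 0" using neg that by (simp add: mult_nonneg_nonpos)
    then show ?thesis
      using ln_upper[of "x - y" y] ln_lower[of "x - y" y] that by (simp add: algebra_simps)
  qed
  have "(- ln l)-lipschitz_on UNIV (\<lambda>s. ln (G s))"
  proof (rule lipschitz_onI)
    fix x y :: real
    show "dist (ln (G x)) (ln (G y)) \<le> - ln l * dist x y"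
      using one_sided[of x y] one_sided[of y x]
      by (cases "y \<le> x") (auto simp: dist_real_def abs_minus_commute)
  qed (use neg in simp)
  then have cont: "isCont (\<lambda>s. ln (G s)) x" for x
    using lipschitz_on_continuous_on continuous_on_eq_continuous_at[OF open_UNIV] by blast
  \<comment> \<open>At rate \<open>ln r\<close>, a shift by \<open>h\<close> lowers
    \<open>ln G\<close> by at least \<open>\<bar>ln (G 0)\<bar>\<close>, so the signs at
    \<open>h\<close> and \<open>- h\<close> are opposite or zero.\<close>
  define h where "h = \<bar>ln (G 0)\<bar> / - ln r"
  have h: "0 \<le> h" "h * ln r = - \<bar>ln (G 0)\<bar>" using neg by (simp_all add: h_def field_simps)
  have "ln (G h) \<le> 0" "0 \<le> ln (G (- h))"
    using ln_upper[of h 0] ln_upper[of h "- h"] h by auto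
  then obtain s where "ln (G s) = 0"
    using IVT2[of "\<lambda>s. ln (G s)" h 0 "- h"] cont h(1) by auto
  then have "G s = 1" using pos[of s] by simp
  then show ?thesis
    by (metis antisym geom_decreasing_le_iff[OF assms] order_refl)
qed


section \<open>Multiplicative weights and their pressure\<close>

text \<open>With \<open>g i = p i powr q\<close> this is the summand defining \<open>gammaA\<close>;
  exchanging \<open>c\<close> and \<open>d\<close> gives that of \<open>gammaB\<close>, so one
  constant serves both.\<close>

definition wt ::
  "('i \<Rightarrow> real) \<Rightarrow> ('i \<Rightarrow> real) \<Rightarrow> ('i \<Rightarrow> real) \<Rightarrow> real \<Rightarrow> real \<Rightarrow> 'i \<Rightarrow> real" where
  "wt g c d t s i = g i * c i powr t * d i powr (s - t)"

definition phi ::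
  "('i \<Rightarrow> real) \<Rightarrow> ('i \<Rightarrow> real) \<Rightarrow> ('i \<Rightarrow> real) \<Rightarrow> real \<Rightarrow> real \<Rightarrow> real \<Rightarrow> 'i list \<Rightarrow> real" where
  "phi g c d t u s w =
     word_prod (if word_prod d w \<le> word_prod c w then wt g c d t s else wt g d c u s) w"

text \<open>The numbers \<open>t\<close> and \<open>u\<close> stand for \<open>tau1\<close> and
  \<open>tau2\<close> at a fixed \<open>q\<close>, and \<open>g\<close> for
  \<open>p powr q\<close>.\<close>

locale weighted_diagonal_system =
  fixes I :: "'i set" and g c d :: "'i \<Rightarrow> real" and t u :: real
  assumes finite_I: "finite I" and I_ne: "I \<noteq> {}"
    and g_pos: "\<And>i. i \<in> I \<Longrightarrow> 0 < g i"
    and c_range: "\<And>i. i \<in> I \<Longrightarrow> 0 < c i \<and> c i < 1"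
    and d_range: "\<And>i. i \<in> I \<Longrightarrow> 0 < d i \<and> d i < 1"
begin

text \<open>Exchanging the coordinates, together with \<open>t\<close> and \<open>u\<close>, carries
  every result on \<open>a\<close> to one on \<open>b\<close>.\<close>

lemma swap: "weighted_diagonal_system I g d c"
  by unfold_locales (fact finite_I I_ne g_pos c_range d_range)+

definition a :: "real \<Rightarrow> real" where "a s = (\<Sum>i\<in>I. wt g c d t s i)"

definition b :: "real \<Rightarrow> real" where "b s = (\<Sum>i\<in>I. wt g d c u s i)"

definition Phi :: "real \<Rightarrow> nat \<Rightarrow> real" where
  "Phi s k = (\<Sum>w\<in>words I k. phi g c d t u s w)"

definition P :: "real \<Rightarrow> real" where
  "P s = lim (\<lambda>k. root k (Phi s k))"

lemma wt_pos: "i \<in> I \<Longrightarrow> 0 < wt g c d t s i" "i \<in> I \<Longrightarrow> 0 < wt g d c u s i"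
  using g_pos[of i] c_range[of i] d_range[of i] by (simp_all add: wt_def)

lemma word_prod_wt:
  assumes "w \<in> words I k"
  shows "word_prod (wt g c d t s) w
    = word_prod g w * word_prod c w powr t * word_prod d w powr (s - t)"
proof -
  have "word_prod (wt g c d t s) w = word_prod (\<lambda>i. (g i * c i powr t) * d i powr (s - t)) w"
    by (simp add: wt_def[abs_def])
  also have "\<dots> = word_prod g w * word_prod (\<lambda>i. c i powr t) w * word_prod (\<lambda>i. d i powr (s - t)) w"
    by (simp only: word_prod_mult)
  also have "word_prod (\<lambda>i. c i powr t) w = word_prod c w powr t"
    by (rule word_prod_powr[OF _ assms]) (use c_range in auto)
  also have "word_prod (\<lambda>i. d i powr (s - t)) w = word_prod d w powr (s - t)"
    by (rule word_prod_powr[OF _ assms]) (use d_range in auto)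
  finally show ?thesis .
qed

lemmas word_prod_wt' = weighted_diagonal_system.word_prod_wt[OF swap]

lemma word_prod_pos':
  assumes "w \<in> words I k"
  shows "0 < word_prod c w" "0 < word_prod d w" "0 < word_prod g w"
    "0 < word_prod (wt g c d t s) w" "0 < word_prod (wt g d c u s) w"
  by (rule word_prod_pos[OF _ assms]; simp add: c_range d_range g_pos wt_pos)+

section \<open>Comparison of the two weights of a word\<close>

lemma wt_ratio:
  assumes "w \<in> words I k"
  shows "word_prod (wt g d c u s) w =
    word_prod (wt g c d t s) w * (word_prod c w / word_prod d w) powr (s - (t + u))"
proof -
  let ?C = "word_prod c w" and ?D = "word_prod d w" and ?h = "s - (t + u)"
  have pos: "0 < ?C" "0 < ?D" using word_prod_pos'[OF assms] by auto
  have "?C powr (s - u) = ?C powr t * ?C powr ?h" "?D powr (s - t) = ?D powr u * ?D powr ?h"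
    by (simp_all add: powr_add[symmetric] algebra_simps)
  then show ?thesis
    using pos by (simp add: word_prod_wt[OF assms] word_prod_wt'[OF assms] powr_divide)
qed

text \<open>The exchange permutes the two cases; on a tie
  \<open>word_prod c w = word_prod d w\<close> the ratio is 1 and both weights agree.\<close>

lemma phi_swap:
  assumes "w \<in> words I k"
  shows "phi g d c u t s w = phi g c d t u s w"
  using wt_ratio[OF assms, of s] word_prod_pos'[OF assms] by (auto simp: phi_def)

lemma Phi_swap: "weighted_diagonal_system.Phi I g d c u t = Phi"
  by (intro ext) (simp add: Phi_def weighted_diagonal_system.Phi_def[OF swap] phi_swap)

lemma P_swap: "weighted_diagonal_system.P I g d c u t = P"
  by (intro ext) (simp add: P_def weighted_diagonal_system.P_def[OF swap] Phi_swap)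

lemma a_swap: "weighted_diagonal_system.a I g d c u = b"
  by (intro ext) (simp add: b_def weighted_diagonal_system.a_def[OF swap])

text \<open>The case in \<open>phi\<close> is decided by whether \<open>1 \<le> x\<close>. As the
  exponent \<open>s - (t + u)\<close> is nonpositive, the power of \<open>x\<close> is then at most
  1, and at least 1 otherwise, so the larger weight is chosen.\<close>

lemma phi_eq_max:
  assumes w: "w \<in> words I k" and s: "s \<le> t + u"
  shows "phi g c d t u s w = max (word_prod (wt g c d t s) w) (word_prod (wt g d c u s) w)"
proof -
  define x where "x = word_prod c w / word_prod d w"
  define A where "A = word_prod (wt g c d t s) w"
  have "0 < x" "0 < A" using word_prod_pos'[OF w] by (simp_all add: x_def A_def)
  have B: "word_prod (wt g d c u s) w = A * x powr (s - (t + u))"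
    using wt_ratio[OF w] by (simp add: x_def A_def)
  have iff: "word_prod d w \<le> word_prod c w \<longleftrightarrow> 1 \<le> x"
    using word_prod_pos'[OF w] by (simp add: x_def)
  show ?thesis
  proof (cases "1 \<le> x")
    case True
    then have "x powr (s - (t + u)) \<le> x powr 0" using s by (intro powr_mono) auto
    then have "A * x powr (s - (t + u)) \<le> A * 1"
      using \<open>0 < x\<close> \<open>0 < A\<close> by (intro mult_left_mono) simp_all
    then show ?thesis using True iff by (simp add: phi_def B A_def[symmetric])
  next
    case False
    then have "x powr 0 \<le> x powr (s - (t + u))"
      using s \<open>0 < x\<close> by (intro powr_mono') auto
    then have "A * 1 \<le> A * x powr (s - (t + u))"
      using \<open>0 < x\<close> \<open>0 < A\<close> by (intro mult_left_mono) simp_all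
    then show ?thesis using False iff by (simp add: phi_def B A_def[symmetric])
  qed
qed

text \<open>Now the exponent is nonnegative, which reverses both comparisons.\<close>

lemma phi_eq_min:
  assumes w: "w \<in> words I k" and s: "t + u \<le> s"
  shows "phi g c d t u s w = min (word_prod (wt g c d t s) w) (word_prod (wt g d c u s) w)"
proof -
  define x where "x = word_prod c w / word_prod d w"
  define A where "A = word_prod (wt g c d t s) w"
  have "0 < x" "0 < A" using word_prod_pos'[OF w] by (simp_all add: x_def A_def)
  have B: "word_prod (wt g d c u s) w = A * x powr (s - (t + u))"
    using wt_ratio[OF w] by (simp add: x_def A_def)
  have iff: "word_prod d w \<le> word_prod c w \<longleftrightarrow> 1 \<le> x"
    using word_prod_pos'[OF w] by (simp add: x_def)
  show ?thesis
  proof (cases "1 \<le> x")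
    case True
    then have "x powr 0 \<le> x powr (s - (t + u))" using s by (intro powr_mono) auto
    then have "A * 1 \<le> A * x powr (s - (t + u))"
      using \<open>0 < x\<close> \<open>0 < A\<close> by (intro mult_left_mono) simp_all
    then show ?thesis using True iff by (simp add: phi_def B A_def[symmetric])
  next
    case False
    then have "x powr (s - (t + u)) \<le> x powr 0"
      using s \<open>0 < x\<close> by (intro powr_mono') auto
    then have "A * x powr (s - (t + u)) \<le> A * 1"
      using \<open>0 < x\<close> \<open>0 < A\<close> by (intro mult_left_mono) simp_all
    then show ?thesis using False iff by (simp add: phi_def B A_def[symmetric])
  qed
qed

lemma phi_pos: "w \<in> words I k \<Longrightarrow> 0 < phi g c d t u s w"
  by (simp add: phi_def word_prod_pos')

lemma words_ne: "words I k \<noteq> {}"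
proof -
  obtain i where "i \<in> I" using I_ne by blast
  then have "replicate k i \<in> words I k" by (auto simp: words_def)
  then show ?thesis by blast
qed

lemma Phi_pos: "0 < Phi s k"
  unfolding Phi_def by (intro sum_pos finite_words[OF finite_I] words_ne phi_pos)

lemma a_pos: "0 < a s"
  unfolding a_def by (intro sum_pos finite_I I_ne wt_pos)

lemma b_pos: "0 < b s"
  unfolding b_def by (intro sum_pos finite_I I_ne wt_pos)

section \<open>Growth of the word sums and existence of the pressure\<close>

lemma Phi_le_power:
  assumes "t + u \<le> s"
  shows "Phi s k \<le> a s ^ k"
  unfolding Phi_def a_def sum_word_prod[symmetric]
  by (intro sum_mono) (simp add: phi_eq_min[OF _ assms])

text \<open>For positive numbers the product of two minima is at most the minimum of the
  products.\<close>

lemma Phi_supermultiplicative: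
  assumes "t + u \<le> s"
  shows "Phi s m * Phi s n \<le> Phi s (m + n)"
proof -
  have "Phi s m * Phi s n
      = (\<Sum>v\<in>words I m. \<Sum>w\<in>words I n. phi g c d t u s v * phi g c d t u s w)"
    by (simp add: Phi_def sum_product)
  also have "\<dots> \<le> (\<Sum>v\<in>words I m. \<Sum>w\<in>words I n. phi g c d t u s (v @ w))"
  proof (intro sum_mono)
    fix v w assume vw: "v \<in> words I m" "w \<in> words I n"
    then have "v @ w \<in> words I (m + n)" by (auto simp: words_def)
    from phi_eq_min[OF this assms]
    show "phi g c d t u s v * phi g c d t u s w \<le> phi g c d t u s (v @ w)"
      using word_prod_pos'[OF vw(1)] word_prod_pos'[OF vw(2)] vw
      by (simp add: phi_eq_min[OF _ assms] mult_mono less_imp_le)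
  qed
  finally show ?thesis by (simp add: Phi_def sum_words_add)
qed

text \<open>With \<open>M\<close> the larger letter sum, \<open>Phi s k\<close> lies between
  \<open>M ^ k\<close> and \<open>2 * M ^ k\<close>, and the factor 2 disappears under the
  root.\<close>

lemma root_Phi_max:
  assumes "s \<le> t + u"
  shows "(\<lambda>k. root k (Phi s k)) \<longlonglongrightarrow> max (a s) (b s)"
proof (rule real_tendsto_sandwich)
  define M where "M = max (a s) (b s)"
  have M: "0 < M" "a s \<le> M" "b s \<le> M" using a_pos[of s] by (simp_all add: M_def)
  have lower: "M ^ k \<le> Phi s k" for k
  proof -
    have "a s ^ k \<le> Phi s k" "b s ^ k \<le> Phi s k"
      unfolding Phi_def a_def b_def sum_word_prod[symmetric]
      by (intro sum_mono, simp add: phi_eq_max[OF _ assms])+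
    then show ?thesis by (simp add: M_def max_def)
  qed
  have upper: "Phi s k \<le> 2 * M ^ k" for k
  proof -
    have "Phi s k \<le> (\<Sum>w\<in>words I k. word_prod (wt g c d t s) w + word_prod (wt g d c u s) w)"
      unfolding Phi_def
      by (intro sum_mono) (simp add: phi_eq_max[OF _ assms] less_imp_le[OF word_prod_pos'(4)]
           less_imp_le[OF word_prod_pos'(5)])
    also have "\<dots> = a s ^ k + b s ^ k" by (simp add: sum.distrib sum_word_prod a_def b_def)
    also have "\<dots> \<le> M ^ k + M ^ k"
      using M a_pos[of s] b_pos[of s] by (intro add_mono power_mono) auto
    finally show ?thesis by simp
  qed
  show "\<forall>\<^sub>F k in sequentially. M \<le> root k (Phi s k)"
  proof (rule eventually_sequentiallyI[of 1])
    fix k :: nat assume "1 \<le> k"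
    then show "M \<le> root k (Phi s k)"
      using real_root_le_mono[OF _ lower[of k], of k] M by (simp add: real_root_power_cancel)
  qed
  show "\<forall>\<^sub>F k in sequentially. root k (Phi s k) \<le> root k 2 * M"
  proof (rule eventually_sequentiallyI[of 1])
    fix k :: nat assume "1 \<le> k"
    then show "root k (Phi s k) \<le> root k 2 * M"
      using real_root_le_mono[OF _ upper[of k], of k] M
      by (simp add: real_root_power_cancel real_root_mult)
  qed
  show "(\<lambda>k. M) \<longlonglongrightarrow> max (a s) (b s)" by (simp add: M_def)
  show "(\<lambda>k. root k 2 * M) \<longlonglongrightarrow> max (a s) (b s)"
    using tendsto_mult[OF LIMSEQ_root_const[of 2] tendsto_const[of M]] by (simp add: M_def)
qed

lemma root_Phi_convergent: "\<exists>L>0. (\<lambda>k. root k (Phi s k)) \<longlonglongrightarrow> L"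
proof (cases "s \<le> t + u")
  case True
  then show ?thesis
    using root_Phi_max a_pos[of s] by (intro exI[of _ "max (a s) (b s)"]) auto
next
  case False
  then have s: "t + u \<le> s" by simp
  have "convergent (\<lambda>k. ln (Phi s k) / real k)"
  proof (rule fekete)
    show "ln (Phi s m) + ln (Phi s n) \<le> ln (Phi s (m + n))" for m n
      using Phi_supermultiplicative[OF s, of m n] Phi_pos by (simp add: ln_mult_pos[symmetric])
    show "ln (Phi s k) \<le> real k * ln (a s)" for k
      using Phi_le_power[OF s, of k] Phi_pos[of s k] a_pos[of s]
      by (simp add: ln_realpow[symmetric])
  qed
  then obtain L where "(\<lambda>k. ln (Phi s k) / real k) \<longlonglongrightarrow> L" by (auto simp: convergent_def)
  then have "(\<lambda>k. exp (ln (Phi s k) / real k)) \<longlonglongrightarrow> exp L" by (rule tendsto_exp)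
  \<comment> \<open>The sequences differ at \<open>k = 0\<close>: \<open>root 0\<close> is 0, while
    division by 0 gives \<open>exp 0 = 1\<close>.\<close>
  moreover have "\<forall>\<^sub>F k in sequentially. exp (ln (Phi s k) / real k) = root k (Phi s k)"
  proof (rule eventually_sequentiallyI[of 1])
    fix k :: nat assume "1 \<le> k"
    then show "exp (ln (Phi s k) / real k) = root k (Phi s k)"
      using Phi_pos[of s k] by (simp flip: root_exp)
  qed
  ultimately have "(\<lambda>k. root k (Phi s k)) \<longlonglongrightarrow> exp L"
    by (rule Lim_transform_eventually)
  then show ?thesis by (auto intro: exI[of _ "exp L"])
qed

lemma P_limit: "(\<lambda>k. root k (Phi s k)) \<longlonglongrightarrow> P s" and P_pos: "0 < P s"
  using root_Phi_convergent[of s] by (auto simp: P_def limI)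

lemma P_eq_max: "s \<le> t + u \<Longrightarrow> P s = max (a s) (b s)"
  using LIMSEQ_unique[OF P_limit root_Phi_max] .

lemma P_le_a:
  assumes "t + u \<le> s"
  shows "P s \<le> a s"
proof (rule LIMSEQ_le_const2[OF P_limit], intro exI[of _ 1] allI impI)
  fix k :: nat assume "1 \<le> k"
  then show "root k (Phi s k) \<le> a s"
    using real_root_le_mono[OF _ Phi_le_power[OF assms, of k], of k] a_pos[of s]
    by (simp add: real_root_power_cancel)
qed

text \<open>Domination passes to products, so every word falls in the first case of
  \<open>phi\<close> and the word sum is an exact power.\<close>

lemma P_eq_a:
  assumes "\<And>i. i \<in> I \<Longrightarrow> d i \<le> c i"
  shows "P s = a s"
proof -
  have "word_prod d w \<le> word_prod c w" if "w \<in> words I k" for w k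
    by (rule word_prod_mono[OF _ that]) (use assms d_range in auto)
  then have Phi: "Phi s k = a s ^ k" for k
    by (simp add: Phi_def phi_def a_def sum_word_prod[symmetric])
  have "(\<lambda>k. root k (Phi s k)) \<longlonglongrightarrow> a s"
    by (rule tendsto_eventually, rule eventually_sequentiallyI[of 1])
       (use a_pos[of s] in \<open>simp add: Phi real_root_power_cancel\<close>)
  then show ?thesis using P_limit LIMSEQ_unique by blast
qed

section \<open>Geometric decay in the exponent\<close>

lemma contraction_bounds:
  obtains l r :: real where "0 < l" "l < 1" "0 < r" "r < 1"
    "\<And>i. i \<in> I \<Longrightarrow> l \<le> c i \<and> c i \<le> r \<and> l \<le> d i \<and> d i \<le> r"
proof
  let ?V = "c ` I \<union> d ` I"
  have V: "finite ?V" "?V \<noteq> {}" "\<And>x. x \<in> ?V \<Longrightarrow> 0 < x \<and> x < 1"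
    using finite_I I_ne c_range d_range by auto
  show "0 < Min ?V" "Min ?V < 1" "0 < Max ?V" "Max ?V < 1"
    using V(3)[OF Min_in[OF V(1,2)]] V(3)[OF Max_in[OF V(1,2)]] by auto
  show "Min ?V \<le> c i \<and> c i \<le> Max ?V \<and> Min ?V \<le> d i \<and> d i \<le> Max ?V" if "i \<in> I" for i
    using V(1) that by (auto intro: Min_le Max_ge)
qed

lemma a_geom_decreasing: "geom_decreasing a"
proof -
  obtain l r where lr: "0 < l" "l < 1" "0 < r" "r < 1"
    and bounds: "\<And>i. i \<in> I \<Longrightarrow> l \<le> c i \<and> c i \<le> r \<and> l \<le> d i \<and> d i \<le> r"
    using contraction_bounds by blast
  have "l powr h * a s \<le> a (s + h) \<and> a (s + h) \<le> r powr h * a s" if "0 \<le> h" for s h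
  proof -
    have shift: "wt g c d t (s + h) i = d i powr h * wt g c d t s i" for i
      by (simp add: wt_def powr_add[symmetric] algebra_simps)
    have "l powr h \<le> d i powr h" "d i powr h \<le> r powr h" if "i \<in> I" for i
      using bounds[OF that] d_range[OF that] lr \<open>0 \<le> h\<close> by (auto intro!: powr_mono2)
    then show ?thesis
      unfolding a_def sum_distrib_left shift
      by (intro conjI sum_mono mult_right_mono less_imp_le[OF wt_pos(1)])
  qed
  then show ?thesis unfolding geom_decreasing_def using a_pos lr by blast
qed

lemma phi_shift:
  assumes "w \<in> words I k"
  shows "phi g c d t u (s + h) w = min (word_prod c w) (word_prod d w) powr h * phi g c d t u s w"
  by (simp add: phi_def word_prod_wt[OF assms] word_prod_wt'[OF assms] min_def
      powr_add[symmetric] algebra_simps)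

text \<open>The factor in \<open>phi_shift\<close> lies between \<open>(l powr h) ^ k\<close> and
  \<open>(r powr h) ^ k\<close> on words of length \<open>k\<close>; the bounds on
  \<open>Phi\<close> survive the \<open>k\<close>-th root and the limit.\<close>

lemma P_geom_decreasing: "geom_decreasing P"
proof -
  obtain l r where lr: "0 < l" "l < 1" "0 < r" "r < 1"
    and bounds: "\<And>i. i \<in> I \<Longrightarrow> l \<le> c i \<and> c i \<le> r \<and> l \<le> d i \<and> d i \<le> r"
    using contraction_bounds by blast
  have "l powr h * P s \<le> P (s + h) \<and> P (s + h) \<le> r powr h * P s" if h: "0 \<le> h" for s h
  proof -
    have powr_power: "(x powr h) ^ k = (x ^ k) powr h" if "0 < x" for x :: real and k
      using that by (simp add: powr_realpow[symmetric] powr_powr mult.commute)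
    have factor: "(l powr h) ^ k \<le> min (word_prod c w) (word_prod d w) powr h
        \<and> min (word_prod c w) (word_prod d w) powr h \<le> (r powr h) ^ k" if w: "w \<in> words I k" for w k
    proof -
      \<comment> \<open>The minimum is at most \<open>word_prod c w\<close>, so one upper bound is
        enough.\<close>
      have "l ^ k \<le> word_prod c w" "l ^ k \<le> word_prod d w" "word_prod c w \<le> r ^ k"
        unfolding word_prod_const[OF w, symmetric]
        by (intro word_prod_mono[OF _ w]; use bounds lr c_range d_range in force)+
      then show ?thesis
        using lr word_prod_pos'[OF w] h by (auto simp: powr_power intro!: powr_mono2)
    qed
    have Phi: "(l powr h) ^ k * Phi s k \<le> Phi (s + h) k"
      "Phi (s + h) k \<le> (r powr h) ^ k * Phi s k" for k
      unfolding Phi_def sum_distrib_left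
      by (intro sum_mono; simp add: phi_shift; intro mult_right_mono;
          simp add: factor less_imp_le[OF phi_pos])+
    have root: "root k ((x powr h) ^ k * Phi s k) = x powr h * root k (Phi s k)"
      if "1 \<le> k" for x :: real and k
      using that by (simp add: real_root_mult real_root_power_cancel)
    show ?thesis
    proof
      show "l powr h * P s \<le> P (s + h)"
      proof (rule LIMSEQ_le[OF tendsto_mult_left[OF P_limit] P_limit], intro exI[of _ 1] allI impI)
        fix k :: nat assume "1 \<le> k"
        then show "l powr h * root k (Phi s k) \<le> root k (Phi (s + h) k)"
          using real_root_le_mono[OF _ Phi(1)[of k], of k] by (simp add: root)
      qed
      show "P (s + h) \<le> r powr h * P s"
      proof (rule LIMSEQ_le[OF P_limit tendsto_mult_left[OF P_limit]], intro exI[of _ 1] allI impI)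
        fix k :: nat assume "1 \<le> k"
        then show "root k (Phi (s + h) k) \<le> r powr h * root k (Phi s k)"
          using real_root_le_mono[OF _ Phi(2)[of k], of k] by (simp add: root)
      qed
    qed
  qed
  then show ?thesis unfolding geom_decreasing_def using P_pos lr by blast
qed

section \<open>Lower bound for the pressure under nonnegative drift\<close>

lemma P_ge_one:
  assumes s: "t + u \<le> s" and sum1: "a s = 1"
    and drift: "0 \<le> (\<Sum>i\<in>I. wt g c d t s i * ln (c i / d i))"
  shows "1 \<le> P s"
proof -
  define A where "A = wt g c d t s"
  \<comment> \<open>\<open>X i\<close> is the logarithm of the ratio of the two weights of the
    letter \<open>i\<close>, \<open>m\<close> its mean under \<open>A\<close>, and \<open>Y\<close>
    the centred step.\<close>
  define X where "X i = (s - (t + u)) * ln (c i / d i)" for i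
  define m where "m = (\<Sum>i\<in>I. A i * X i)"
  define Y where "Y i = X i - m" for i
  define V where "V = (\<Sum>i\<in>I. A i * (Y i)\<^sup>2)"
  have A_sum: "(\<Sum>i\<in>I. A i) = 1" using sum1 by (simp add: a_def A_def)
  have "m = (s - (t + u)) * (\<Sum>i\<in>I. A i * ln (c i / d i))"
    by (simp add: m_def X_def sum_distrib_left algebra_simps)
  then have m: "0 \<le> m" using drift s by (simp add: A_def)
  have Y_mean: "(\<Sum>i\<in>I. A i * Y i) = 0"
    by (simp add: Y_def right_diff_distrib sum_subtractf sum_distrib_right[symmetric] A_sum m_def)
  have lower: "exp (- (sqrt (real k) * (1 + V) / 2)) \<le> Phi s k" if k: "1 \<le> k" for k
  proof -
    \<comment> \<open>As the total drift \<open>real k * m\<close> is nonnegative,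
      \<open>Z w\<close> lies below both 0 and the logarithm of the ratio of the weights, so
      \<open>exp (Z w)\<close> bounds the minimum of 1 and that ratio from below.\<close>
    define Z where "Z w = - \<bar>sum_list (map Y w)\<bar>" for w
    define e where "e = (\<Sum>w\<in>words I k. word_prod A w * Z w)"
    have A_pos: "0 < word_prod A w" if "w \<in> words I k" for w
      using word_prod_pos'(4)[OF that] by (simp add: A_def)
    have phi: "word_prod A w * exp (Z w) \<le> phi g c d t u s w" if w: "w \<in> words I k" for w
    proof -
      have len: "length w = k" using w by (simp add: words_def)
      have "ln (word_prod c w / word_prod d w) = sum_list (map (\<lambda>i. ln (c i / d i)) w)"
      proof -
        have "ln (word_prod c w / word_prod d w) = ln (word_prod c w) - ln (word_prod d w)"
          using word_prod_pos'[OF w] by (simp add: ln_div)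
        also have "\<dots> = sum_list (map (\<lambda>i. ln (c i)) w) - sum_list (map (\<lambda>i. ln (d i)) w)"
          using c_range d_range by (simp add: ln_word_prod[OF _ w])
        also have "\<dots> = sum_list (map (\<lambda>i. ln (c i) - ln (d i)) w)"
          by (simp add: sum_list_subtractf)
        also have "\<dots> = sum_list (map (\<lambda>i. ln (c i / d i)) w)"
          using w c_range d_range
          by (intro arg_cong[where f = sum_list] map_cong) (force simp: words_def ln_div)+
        finally show ?thesis .
      qed
      then have "(s - (t + u)) * ln (word_prod c w / word_prod d w) = sum_list (map X w)"
        by (simp add: X_def[abs_def] sum_list_const_mult)
      then have ratio: "word_prod (wt g d c u s) w = word_prod A w * exp (sum_list (map X w))"
        using wt_ratio[OF w, of s] word_prod_pos'[OF w] by (simp add: A_def powr_def)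
      have "sum_list (map X w) = sum_list (map Y w) + real k * m"
        by (simp add: Y_def[abs_def] sum_list_subtractf sum_list_triv len)
      then have "Z w \<le> sum_list (map X w)" "Z w \<le> 0"
        using mult_nonneg_nonneg[OF of_nat_0_le_iff[of k] m] unfolding Z_def by linarith+
      then show ?thesis
        using A_pos[OF w] by (simp add: phi_eq_min[OF w s] ratio A_def[symmetric])
    qed
    have tot: "(\<Sum>w\<in>words I k. word_prod A w) = 1" by (simp add: sum_word_prod A_sum)
    \<comment> \<open>Jensen's inequality for \<open>exp\<close>, via the tangent line at the mean \<open>e\<close> of \<open>Z\<close>\<close>
    have "(\<Sum>w\<in>words I k. word_prod A w * (1 + (Z w - e)))
        = (\<Sum>w\<in>words I k. word_prod A w * (1 - e) + word_prod A w * Z w)"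
      by (intro sum.cong refl) (simp add: algebra_simps)
    also have "\<dots> = (\<Sum>w\<in>words I k. word_prod A w) * (1 - e) + e"
      unfolding sum.distrib e_def sum_distrib_right ..
    also have "\<dots> = 1" by (simp add: tot)
    finally have "(\<Sum>w\<in>words I k. word_prod A w * (1 + (Z w - e))) = 1" .
    then have "exp e = exp e * (\<Sum>w\<in>words I k. word_prod A w * (1 + (Z w - e)))"
      by simp
    also have "\<dots> \<le> exp e * (\<Sum>w\<in>words I k. word_prod A w * exp (Z w - e))"
      using A_pos by (intro mult_left_mono sum_mono exp_ge_add_one_self) (auto intro: less_imp_le)
    also have "\<dots> = (\<Sum>w\<in>words I k. word_prod A w * exp (Z w))"
      by (simp add: sum_distrib_left exp_diff mult.left_commute)
    also have "\<dots> \<le> Phi s k" unfolding Phi_def by (intro sum_mono phi)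
    finally have exp_e: "exp e \<le> Phi s k" .
    have "- e = (\<Sum>w\<in>words I k. word_prod A w * \<bar>sum_list (map Y w)\<bar>)"
      by (simp add: e_def Z_def sum_negf)
    \<comment> \<open>The arithmetic-geometric mean inequality replaces the absolute value by a
      square; the scale \<open>sqrt k\<close> balances the two terms, as the second moment is
      \<open>real k * V\<close>.\<close>
    also have "\<dots> \<le> (\<Sum>w\<in>words I k. word_prod A w * ((sqrt k + (sum_list (map Y w))\<^sup>2 / sqrt k) / 2))"
    proof (intro sum_mono mult_left_mono)
      fix w assume w: "w \<in> words I k"
      define y where "y = \<bar>sum_list (map Y w)\<bar>"
      have "0 \<le> (y - sqrt k)\<^sup>2" by simp
      then have "2 * y * sqrt k \<le> y\<^sup>2 + sqrt k * sqrt k"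
        by (simp add: power2_eq_square algebra_simps)
      then have "y \<le> (sqrt k + y\<^sup>2 / sqrt k) / 2"
        using k by (simp add: field_simps del: real_sqrt_mult_self)
      then show "\<bar>sum_list (map Y w)\<bar> \<le> (sqrt k + (sum_list (map Y w))\<^sup>2 / sqrt k) / 2"
        by (simp add: y_def)
      show "0 \<le> word_prod A w" using A_pos[OF w] by simp
    qed
    also have "\<dots> = (sqrt k * (\<Sum>w\<in>words I k. word_prod A w)
        + (\<Sum>w\<in>words I k. word_prod A w * (sum_list (map Y w))\<^sup>2) / sqrt k) / 2"
      by (simp add: sum_distrib_left sum_divide_distrib sum.distrib[symmetric] field_simps)
    also have "\<dots> = (sqrt k + real k * V / sqrt k) / 2"
      using sum_words_second_moment[OF A_sum Y_mean, of k] by (simp add: tot V_def)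
    also have "real k * V / sqrt k = sqrt k * V"
      using real_div_sqrt[of "real k"] by (metis of_nat_0_le_iff times_divide_eq_left)
    finally have "- e \<le> sqrt k * (1 + V) / 2" by (simp add: algebra_simps)
    then have "- (sqrt k * (1 + V) / 2) \<le> e" by linarith
    then show ?thesis using exp_e by (meson exp_le_cancel_iff order_trans)
  qed
  \<comment> \<open>Under the \<open>k\<close>-th root the exponent of order \<open>sqrt k\<close>
    becomes one of order \<open>1 / sqrt k\<close>, so the lower bound tends to 1.\<close>
  have "(\<lambda>k. exp (- ((1 + V) / 2 * (1 / sqrt (real k))))) \<longlonglongrightarrow> exp (- ((1 + V) / 2 * 0))"
    by (intro tendsto_intros) real_asymp
  moreover have "exp (- ((1 + V) / 2 * (1 / sqrt (real k)))) \<le> root k (Phi s k)" if k: "1 \<le> k" for k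
  proof -
    have "1 / sqrt (real k) = sqrt (real k) / real k"
      using sqrt_divide_self_eq[of "real k"] by (simp only: inverse_eq_divide of_nat_0_le_iff)
    then have "(1 + V) / 2 * (1 / sqrt (real k)) = sqrt (real k) * (1 + V) / 2 / real k"
      by (simp only:) (simp add: field_simps)
    then have "exp (- ((1 + V) / 2 * (1 / sqrt (real k)))) = exp (- (sqrt (real k) * (1 + V) / 2) / real k)"
      by (simp only: minus_divide_left)
    also have "\<dots> = root k (exp (- (sqrt (real k) * (1 + V) / 2)))"
      using k by (simp only: root_exp)
    also have "\<dots> \<le> root k (Phi s k)"
      using k lower[OF k] by (intro real_root_le_mono) simp_all
    finally show ?thesis .
  qed
  ultimately have "exp (- ((1 + V) / 2 * 0)) \<le> P s"
    by (intro LIMSEQ_le[OF _ P_limit]) blast+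
  then show ?thesis by simp
qed

section \<open>The three exponents and their comparison\<close>

definition \<alpha> :: real where "\<alpha> = (THE s. a s = 1)"

definition \<beta> :: real where "\<beta> = (THE s. b s = 1)"

definition \<Gamma> :: real where "\<Gamma> = (THE s. P s = 1)"

lemma \<beta>_swap: "\<beta> = weighted_diagonal_system.\<alpha> I g d c u"
  by (simp add: \<beta>_def weighted_diagonal_system.\<alpha>_def[OF swap] a_swap)

lemma \<Gamma>_swap: "weighted_diagonal_system.\<Gamma> I g d c u t = \<Gamma>"
  by (simp add: \<Gamma>_def weighted_diagonal_system.\<Gamma>_def[OF swap] P_swap)

lemma a_\<alpha>: "a \<alpha> = 1"
  unfolding \<alpha>_def by (rule theI'[OF geom_decreasing_ex1[OF a_geom_decreasing]])

lemma b_geom_decreasing: "geom_decreasing b"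
  using weighted_diagonal_system.a_geom_decreasing[OF swap, of u] by (simp add: a_swap)

lemma b_\<beta>: "b \<beta> = 1"
  unfolding \<beta>_def by (rule theI'[OF geom_decreasing_ex1[OF b_geom_decreasing]])

lemma P_\<Gamma>: "P \<Gamma> = 1"
  unfolding \<Gamma>_def by (rule theI'[OF geom_decreasing_ex1[OF P_geom_decreasing]])

lemma \<Gamma>_eqI: "P s = 1 \<Longrightarrow> \<Gamma> = s"
  by (metis P_\<Gamma> P_geom_decreasing antisym geom_decreasing_le_iff order_refl)

text \<open>At the larger of the two roots both letter sums are at most 1 and one of them equals 1,
  so their maximum, which is the pressure there, is 1.\<close>

lemma \<Gamma>_eq_max:
  assumes "max \<alpha> \<beta> \<le> t + u"
  shows "\<Gamma> = max \<alpha> \<beta>"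
proof (rule \<Gamma>_eqI)
  have "a (max \<alpha> \<beta>) \<le> 1" "b (max \<alpha> \<beta>) \<le> 1"
    using geom_decreasing_le_iff[OF a_geom_decreasing, of "max \<alpha> \<beta>" \<alpha>]
      geom_decreasing_le_iff[OF b_geom_decreasing, of "max \<alpha> \<beta>" \<beta>]
    by (simp_all add: a_\<alpha> b_\<beta>)
  then show "P (max \<alpha> \<beta>) = 1"
    unfolding P_eq_max[OF assms] using a_\<alpha> b_\<beta> by (auto simp: max_def split: if_splits)
qed

text \<open>At \<open>\<alpha>\<close> the pressure is at most \<open>a \<alpha> = 1\<close>, and it
  decreases in \<open>s\<close>.\<close>

lemma \<Gamma>_le_\<alpha>:
  assumes "t + u \<le> \<alpha>"
  shows "\<Gamma> \<le> \<alpha>"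
  using P_le_a[OF assms] geom_decreasing_le_iff[OF P_geom_decreasing, of \<alpha> \<Gamma>]
  by (simp add: a_\<alpha> P_\<Gamma>)

lemma \<Gamma>_eq_\<alpha>:
  assumes "t + u \<le> \<alpha>" "0 \<le> (\<Sum>i\<in>I. wt g c d t \<alpha> i * ln (c i / d i))"
  shows "\<Gamma> = \<alpha>"
  using P_le_a[OF assms(1)] P_ge_one[OF assms(1) a_\<alpha> assms(2)] by (intro \<Gamma>_eqI) (simp add: a_\<alpha>)

lemma \<Gamma>_eq_\<alpha>_dominated: "(\<And>i. i \<in> I \<Longrightarrow> d i \<le> c i) \<Longrightarrow> \<Gamma> = \<alpha>"
  by (intro \<Gamma>_eqI) (simp add: P_eq_a a_\<alpha>)

lemma \<Gamma>_le_\<beta>: "t + u \<le> \<beta> \<Longrightarrow> \<Gamma> \<le> \<beta>"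
  using weighted_diagonal_system.\<Gamma>_le_\<alpha>[OF swap, of u t]
  by (simp add: \<beta>_swap \<Gamma>_swap add.commute)

lemma \<Gamma>_eq_\<beta>:
  "t + u \<le> \<beta> \<Longrightarrow> 0 \<le> (\<Sum>i\<in>I. wt g d c u \<beta> i * ln (d i / c i)) \<Longrightarrow> \<Gamma> = \<beta>"
  using weighted_diagonal_system.\<Gamma>_eq_\<alpha>[OF swap, of u t]
  by (simp add: \<beta>_swap \<Gamma>_swap add.commute)

lemma \<Gamma>_eq_\<beta>_dominated: "(\<And>i. i \<in> I \<Longrightarrow> c i \<le> d i) \<Longrightarrow> \<Gamma> = \<beta>"
  using weighted_diagonal_system.\<Gamma>_eq_\<alpha>_dominated[OF swap, of u t]
  by (simp add: \<beta>_swap \<Gamma>_swap)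

end

section \<open>Box-like measures\<close>

context box_like_self_affine_measure
begin

lemma weighted_diagonal_system:
  "weighted_diagonal_system I (\<lambda>i. p i powr q) c d"
proof
  show "I \<noteq> {}" using card_I by auto
  show "0 < p i powr q" if "i \<in> I" for i using p_range[OF that] by simp
qed (use finite_I c_range d_range in auto)

text \<open>\<open>tau_word\<close> switches exactly when \<open>alpha1\<close> changes from the
  \<open>c\<close>-product to the \<open>d\<close>-product, so in each case \<open>psi\<close> is a
  single multiplicative weight.\<close>

lemma psi_eq_phi:
  assumes "w \<in> words I k"
  shows "psi \<mu> c d p s q w = phi (\<lambda>i. p i powr q) c d (tau1 \<mu> q) (tau2 \<mu> q) s w"
proof -
  have "word_prod (\<lambda>i. p i powr q) w = word_prod p w powr q"
    by (rule word_prod_powr[OF _ assms]) (use p_range in auto)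
  then show ?thesis
    by (simp add: psi_def phi_def tau_word_def alpha1_def alpha2_def max_def min_def
        weighted_diagonal_system.word_prod_wt[OF weighted_diagonal_system assms]
        weighted_diagonal_system.word_prod_wt'[OF weighted_diagonal_system assms])
qed

lemma gamma_eq:
  "gamma \<mu> I c d p q =
     weighted_diagonal_system.\<Gamma> I (\<lambda>i. p i powr q) c d (tau1 \<mu> q) (tau2 \<mu> q)"
  by (simp add: gamma_def pressure_def Psi_def psi_eq_phi
      weighted_diagonal_system.\<Gamma>_def[OF weighted_diagonal_system]
      weighted_diagonal_system.P_def[OF weighted_diagonal_system]
      weighted_diagonal_system.Phi_def[OF weighted_diagonal_system] cong: sum.cong)

lemma gammaA_eq:
  "gammaA \<mu> I c d p q = weighted_diagonal_system.\<alpha> I (\<lambda>i. p i powr q) c d (tau1 \<mu> q)"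
  by (simp add: gammaA_def wt_def
      weighted_diagonal_system.\<alpha>_def[OF weighted_diagonal_system]
      weighted_diagonal_system.a_def[OF weighted_diagonal_system])

lemma gammaB_eq:
  "gammaB \<mu> I c d p q = weighted_diagonal_system.\<beta> I (\<lambda>i. p i powr q) c d (tau2 \<mu> q)"
  by (simp add: gammaB_def wt_def
      weighted_diagonal_system.\<beta>_def[OF weighted_diagonal_system]
      weighted_diagonal_system.b_def[OF weighted_diagonal_system])

end

theorem theorem2p10:
  fixes \<mu> :: "(real \<times> real) measure"
    and I :: "'i set"
    and S :: "'i \<Rightarrow> real \<times> real \<Rightarrow> real \<times> real"
    and c d p :: "'i \<Rightarrow> real"
    and q :: real
  assumes "box_like_self_affine_measure \<mu> I S c d p"
    and "q \<ge> 0"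
  shows
    "(max (gammaA \<mu> I c d p q) (gammaB \<mu> I c d p q) \<le> tau1 \<mu> q + tau2 \<mu> q \<longrightarrow>
        gamma \<mu> I c d p q = max (gammaA \<mu> I c d p q) (gammaB \<mu> I c d p q))
     \<and>
     (min (gammaA \<mu> I c d p q) (gammaB \<mu> I c d p q) \<ge> tau1 \<mu> q + tau2 \<mu> q \<longrightarrow>
        gamma \<mu> I c d p q \<le> min (gammaA \<mu> I c d p q) (gammaB \<mu> I c d p q)
        \<and>
        ((\<Sum>i\<in>I. p i powr q * c i powr tau1 \<mu> q * d i powr (gammaA \<mu> I c d p q - tau1 \<mu> q)
            * ln (c i / d i)) \<ge> 0
         \<or>
         (\<Sum>i\<in>I. p i powr q * d i powr tau2 \<mu> q * c i powr (gammaB \<mu> I c d p q - tau2 \<mu> q)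
            * ln (d i / c i)) \<ge> 0
         \<longrightarrow> gamma \<mu> I c d p q = min (gammaA \<mu> I c d p q) (gammaB \<mu> I c d p q)))
     \<and>
     ((\<forall>i\<in>I. c i \<ge> d i) \<longrightarrow> (\<forall>q'\<ge>0. gamma \<mu> I c d p q' = gammaA \<mu> I c d p q'))
     \<and>
     ((\<forall>i\<in>I. d i \<ge> c i) \<longrightarrow> (\<forall>q'\<ge>0. gamma \<mu> I c d p q' = gammaB \<mu> I c d p q'))"
proof -
  interpret box_like_self_affine_measure \<mu> I S c d p by fact
  \<comment> \<open>The exponent stays free, since the two dominated cases speak of all
    \<open>q'\<close>.\<close>
  interpret W: weighted_diagonal_system I "\<lambda>i. p i powr q'" c d "tau1 \<mu> q'" "tau2 \<mu> q'" for q'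
    by (rule weighted_diagonal_system)
  \<comment> \<open>Either drift condition identifies \<open>gamma\<close> with one of the two
    exponents; being bounded by the other as well, it is their minimum.\<close>
  show ?thesis
    unfolding gamma_eq gammaA_eq gammaB_eq
    using W.\<Gamma>_eq_max[of q] W.\<Gamma>_le_\<alpha>[of q] W.\<Gamma>_le_\<beta>[of q] W.\<Gamma>_eq_\<alpha>[of q] W.\<Gamma>_eq_\<beta>[of q]
      W.\<Gamma>_eq_\<alpha>_dominated W.\<Gamma>_eq_\<beta>_dominated
    unfolding wt_def by (auto simp: min_def split: if_splits)
qed

end
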